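(* Let $\mathbf{Q}\in\mathbb{R}^{N\times N}$ be symmetric positive definite, $\mathbf{c}\in\mathbb{R}^N$, and $\gamma>0$. Assume that $$\frac{c_n^2}{(\mathbf{Q}^{-1})_{nn}}\le\gamma\qquad\text{for all } n=1,\ldots,N.$$ Let $B_n^{+}=\sqrt{\gamma(\mathbf{Q}^{-1})_{nn}}+c_n$ and $B_n^{-}=\sqrt{\gamma(\mathbf{Q}^{-1})_{nn}}-c_n$. Then the optimal cost of the continuous relaxation $$\min_{\mathbf{x}^+,\mathbf{x}^-\in\mathbb{R}^N}\ \sum_{n=1}^{N}\left(\frac{x_n^+}{B_n^+}+\frac{x_n^-}{B_n^-}\right)\quad\text{s.t.}\quad(\mathbf{x}^+-\mathbf{x}^--\mathbf{c})^T\mathbf{Q}(\mathbf{x}^+-\mathbf{x}^--\mathbf{c})\le\gamma,\quad \mathbf{x}^+\ge\mathbf{0},\ \mathbf{x}^-\ge\mathbf{0}$$ is bounded from above by $\theta N/2$, where $\theta=1-\sqrt{\gamma/\mathbf{c}^T\mathbf{Q}\mathbf{c}}$.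
   Context: Inequalities between vectors are componentwise. The problem is the continuous relaxation of a mixed-integer formulation of minimizing the number of nonzero components of $\mathbf{x}\in\mathbb{R}^N$ subject to $(\mathbf{x}-\mathbf{c})^T\mathbf{Q}(\mathbf{x}-\mathbf{c})\le\gamma$; the variable $\mathbf{x}$ is split as $\mathbf{x}=\mathbf{x}^+-\mathbf{x}^-$, and $B_n^{\pm}$ is the maximum of $\pm x_n$ over the feasible ellipsoid. The assumption on $c_n^2/(\mathbf{Q}^{-1})_{nn}$ says that for each $n$ there is a feasible $\mathbf{x}$ with $x_n=0$.
   Formalization: Adds the assumption γ ≤ cᵀQc: for 0 < cᵀQc < γ the bound θN/2 is negative while the cost is nonnegative (e.g. N=1, Q=1, c=1, γ=4), and for c=0 θ is undefined. Where a bound B_n^± is 0, x/0 is read as ∞ for x>0 and 0/0 as 0. *)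

theory Defs
  imports "HOL-Analysis.Analysis"
begin

definition symmetric_positive_definite :: "real ^ 'n ^ 'n \<Rightarrow> bool" where
  "symmetric_positive_definite Q \<longleftrightarrow>
     transpose Q = Q \<and> (\<forall>x. x \<noteq> 0 \<longrightarrow> x \<bullet> (Q *v x) > 0)"

definition bound_plus :: "real ^ 'n ^ 'n \<Rightarrow> real ^ 'n \<Rightarrow> real \<Rightarrow> 'n \<Rightarrow> real" where
  "bound_plus Q c \<gamma> n = sqrt (\<gamma> * matrix_inv Q $ n $ n) + c $ n"

definition bound_minus :: "real ^ 'n ^ 'n \<Rightarrow> real ^ 'n \<Rightarrow> real \<Rightarrow> 'n \<Rightarrow> real" where
  "bound_minus Q c \<gamma> n = sqrt (\<gamma> * matrix_inv Q $ n $ n) - c $ n"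

definition relaxation_feasible ::
    "real ^ 'n ^ 'n \<Rightarrow> real ^ 'n \<Rightarrow> real \<Rightarrow> ((real ^ 'n) \<times> (real ^ 'n)) set" where
  "relaxation_feasible Q c \<gamma> =
     {(xp, xm). (xp - xm - c) \<bullet> (Q *v (xp - xm - c)) \<le> \<gamma> \<and>
                (\<forall>n. 0 \<le> xp $ n) \<and> (\<forall>n. 0 \<le> xm $ n)}"

(* The divisions are in ereal because a bound vanishes when
   c_n^2 / (Q^{-1})_nn = \<gamma>.  A zero bound forces the corresponding variable to be 0
   in the mixed-integer formulation (x_n^+ <= B_n^+ i_n^+); ereal division matches this:
   x / 0 = \<infinity> for x > 0 and 0 / 0 = 0, whereas x / 0 = 0 in real would make the
   variable free of charge. *)
definition relaxation_cost ::
    "real ^ 'n ^ 'n \<Rightarrow> real ^ 'n \<Rightarrow> real \<Rightarrow> (real ^ 'n) \<times> (real ^ 'n) \<Rightarrow> ereal" where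
  "relaxation_cost Q c \<gamma> = (\<lambda>(xp, xm).
     \<Sum>n\<in>UNIV. ereal (xp $ n) / ereal (bound_plus Q c \<gamma> n)
            + ereal (xm $ n) / ereal (bound_minus Q c \<gamma> n))"

definition relaxation_optimal_cost ::
    "real ^ 'n ^ 'n \<Rightarrow> real ^ 'n \<Rightarrow> real \<Rightarrow> ereal" where
  "relaxation_optimal_cost Q c \<gamma> =
     (INF p \<in> relaxation_feasible Q c \<gamma>. relaxation_cost Q c \<gamma> p)"

end

theory Submission imports Defs begin

text \<open>
  The bound is witnessed by a single feasible point: shrink the centre \<open>c\<close> of the ellipsoid
  towards the origin until the boundary is met. The point \<open>\<theta> c\<close> differs from the centre by
  \<open>- (1 - \<theta>) c\<close>, whose quadratic form is \<open>(1 - \<theta>)\<^sup>2 c\<^sup>T Q c\<close>, and \<open>\<theta>\<close> is the factor that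
  makes this equal to \<open>\<gamma>\<close> (\<open>shrunk_center_feasible\<close>). It is split into its positive and negative
  parts, so in each coordinate at most one of the two terms of the cost is nonzero.

  With \<open>s\<close> denoting the half-width \<open>sqrt (\<gamma> (Q\<^sup>-\<^sup>1)\<^sub>n\<^sub>n)\<close> of the ellipsoid in direction \<open>n\<close>, the
  remaining term is \<open>\<theta> \<bar>c\<^sub>n\<bar> / (s + \<bar>c\<^sub>n\<bar>)\<close> whatever the sign of \<open>c\<^sub>n\<close>, because the sign selects the
  larger one of the two bounds. The assumption that coordinate \<open>n\<close> can vanish on the ellipsoid says
  exactly \<open>\<bar>c\<^sub>n\<bar> \<le> s\<close>, so the term is at most \<open>\<theta> / 2\<close> (\<open>coordinate_cost_le\<close>). Summing over the
  coordinates gives the claim.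
\<close>

lemma symmetric_positive_definite_invertible:
  fixes Q :: "real ^ 'n ^ 'n"
  assumes "symmetric_positive_definite Q"
  shows "invertible Q"
proof -
  have "x = 0" if "Q *v x = 0" for x
    using assms that unfolding symmetric_positive_definite_def
    by (metis inner_zero_right less_irrefl)
  then show ?thesis
    by (auto simp: invertible_left_inverse matrix_left_invertible_ker)
qed

lemma invertible_mult_matrix_inv:
  fixes A :: "'a::semiring_1 ^ 'n ^ 'm"
  assumes "invertible A"
  shows "A ** matrix_inv A = mat 1"
  using someI_ex[OF assms[unfolded invertible_def]] by (simp add: matrix_inv_def)

text \<open>
  The diagonal entry is the quadratic form of \<open>Q\<close> at \<open>y = Q\<^sup>-\<^sup>1 e\<^sub>n\<close>. Positivity is what gives
  content to the assumption on \<open>c\<^sub>n\<^sup>2 / (Q\<^sup>-\<^sup>1)\<^sub>n\<^sub>n\<close>, since a quotient by \<open>0\<close> would be \<open>0\<close>.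
\<close>

lemma matrix_inv_diagonal_pos:
  fixes Q :: "real ^ 'n ^ 'n"
  assumes "symmetric_positive_definite Q"
  shows "matrix_inv Q $ n $ n > 0"
proof -
  define y where "y = matrix_inv Q *v axis n 1"
  have Qy: "Q *v y = axis n 1"
    using invertible_mult_matrix_inv[OF symmetric_positive_definite_invertible[OF assms]]
    by (simp add: y_def matrix_vector_mul_assoc)
  then have "y \<noteq> 0"
    by (metis axis_eq_0_iff matrix_vector_mult_0_right zero_neq_one)
  then have "0 < y \<bullet> (Q *v y)"
    using assms unfolding symmetric_positive_definite_def by blast
  also have "\<dots> = matrix_inv Q $ n $ n"
    unfolding Qy by (simp add: y_def inner_axis matrix_vector_mult_basis column_def)
  finally show ?thesis .
qed

lemma shrunk_center_feasible:
  fixes Q :: "real ^ 'n ^ 'n"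
  assumes "0 \<le> \<gamma>" "\<gamma> \<le> c \<bullet> (Q *v c)"
    and theta: "\<theta> = 1 - sqrt (\<gamma> / (c \<bullet> (Q *v c)))"
  shows "(\<chi> n. \<theta> * max (c $ n) 0, \<chi> n. \<theta> * max (- c $ n) 0) \<in> relaxation_feasible Q c \<gamma>"
proof -
  let ?q = "c \<bullet> (Q *v c)"
  let ?xp = "\<chi> n. \<theta> * max (c $ n) 0" and ?xm = "\<chi> n. \<theta> * max (- c $ n) 0"
  have "0 \<le> ?q"
    using assms by linarith
  then have "\<gamma> / ?q \<le> 1"
    using assms by (auto simp: divide_le_eq_1)
  then have "0 \<le> \<theta>"
    by (simp add: theta)
  have diff: "?xp - ?xm - c = (- sqrt (\<gamma> / ?q)) *\<^sub>R c"
    by (auto simp: vec_eq_iff theta max_def algebra_simps)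
  have "(?xp - ?xm - c) \<bullet> (Q *v (?xp - ?xm - c)) = (sqrt (\<gamma> / ?q))\<^sup>2 * ?q"
    unfolding diff matrix_vector_mult_scaleR
    by (simp add: power2_eq_square mult.assoc del: real_sqrt_mult_self)
  also have "\<dots> = \<gamma> / ?q * ?q"
    using assms \<open>0 \<le> ?q\<close> by simp
  also have "\<dots> \<le> \<gamma>"
    using assms by (cases "?q = 0") auto
  finally show ?thesis
    using \<open>0 \<le> \<theta>\<close> by (simp add: relaxation_feasible_def)
qed

text \<open>
  One of the two numerators is \<open>0\<close>, and \<open>0\<close> divided by a vanishing bound is still \<open>0\<close>. For
  \<open>a \<noteq> 0\<close> the denominator of the other term is \<open>s + \<bar>a\<bar> \<ge> 2 \<bar>a\<bar> > 0\<close>.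
\<close>

lemma coordinate_cost_le:
  fixes a s \<theta> :: real
  assumes "0 \<le> \<theta>" "\<bar>a\<bar> \<le> s"
  shows "ereal (\<theta> * max a 0) / ereal (s + a) + ereal (\<theta> * max (- a) 0) / ereal (s - a)
    \<le> ereal (\<theta> / 2)"
proof -
  have half: "\<theta> * t / (s + t) \<le> \<theta> / 2" if "0 < t" "t \<le> s" for t
    using that assms(1) mult_left_mono[of t s \<theta>] by (simp add: field_simps)
  consider "a = 0" | "0 < a" | "a < 0"
    by linarith
  then show ?thesis
  proof cases
    case 1
    then show ?thesis
      using assms by (simp add: zero_ereal_def[symmetric])
  next
    case 2
    then show ?thesis
      using assms half[of a] by (simp add: zero_ereal_def[symmetric])
  next
    case 3
    then show ?thesis
      using assms half[of "- a"] by (simp add: zero_ereal_def[symmetric])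
  qed
qed

theorem proposition3p1:
  fixes Q :: "real ^ 'n ^ 'n" and c :: "real ^ 'n" and \<gamma> \<theta> :: real
  assumes Q: "symmetric_positive_definite Q"
    and gamma_pos: "\<gamma> > 0"
    and zero_component_feasible: "\<And>n. (c $ n)\<^sup>2 / (matrix_inv Q $ n $ n) \<le> \<gamma>"
    and nontrivial: "\<gamma> \<le> c \<bullet> (Q *v c)"
    and theta: "\<theta> = 1 - sqrt (\<gamma> / (c \<bullet> (Q *v c)))"
  shows "relaxation_optimal_cost Q c \<gamma> \<le> ereal (\<theta> * real CARD('n) / 2)"
proof -
  let ?p = "(\<chi> n. \<theta> * max (c $ n) 0, \<chi> n. \<theta> * max (- c $ n) 0)"
  have "0 \<le> \<theta>"
    using gamma_pos nontrivial by (simp add: theta)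
  have center_le: "\<bar>c $ n\<bar> \<le> sqrt (\<gamma> * matrix_inv Q $ n $ n)" for n
    using zero_component_feasible[of n] matrix_inv_diagonal_pos[OF Q, of n]
    by (intro real_le_rsqrt) (simp add: pos_divide_le_eq)
  have "relaxation_optimal_cost Q c \<gamma> \<le> relaxation_cost Q c \<gamma> ?p"
    unfolding relaxation_optimal_cost_def
    using shrunk_center_feasible[of \<gamma> c Q \<theta>] gamma_pos nontrivial theta
    by (intro INF_lower) auto
  also have "\<dots> \<le> (\<Sum>n\<in>(UNIV :: 'n set). ereal (\<theta> / 2))"
    unfolding relaxation_cost_def bound_plus_def bound_minus_def prod.case vec_lambda_beta
    by (intro sum_mono coordinate_cost_le \<open>0 \<le> \<theta>\<close> center_le)
  also have "\<dots> = ereal (\<theta> * real CARD('n) / 2)"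
    by (simp add: sum_ereal mult.commute)
  finally show ?thesis .
qed

end
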